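(* For every positive integer $k$, \[ \mu(1+x+y_1+z_1,\ \ldots,\ 1+x+y_k+z_k) \;=\; \frac{1}{\pi^{k+1}}\int_0^\pi \left(\theta\log\left(2\sin\frac{\theta}{2}\right) + \mathrm{Cl}_2(\theta)\right)^k\,\mathrm{d}\theta, \] where the left-hand side is the multiple Mahler measure of the $k$ polynomials $1+x+y_j+z_j$ in the $2k+1$ variables $x,y_1,\dots,y_k,z_1,\dots,z_k$.
   Context: For functions $P_1,\ldots,P_k$ of $n$ variables, the multiple Mahler measure is \[ \mu(P_1,\ldots,P_k) := \int_0^1\cdots\int_0^1 \prod_{j=1}^k \log\left|P_j\left(e^{2\pi i t_1},\ldots,e^{2\pi i t_n}\right)\right|\,\mathrm{d}t_1\cdots\mathrm{d}t_n . \] The Clausen function is $\mathrm{Cl}_2(\theta) := \sum_{n=1}^\infty \frac{\sin(n\theta)}{n^2}$. *)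

theory Defs
  imports "HOL-Analysis.Analysis"
begin

definition Cl2 :: "real \<Rightarrow> real" where
  "Cl2 \<theta> = (\<Sum>n. sin (real (Suc n) * \<theta>) / (real (Suc n))^2)"

definition multiple_mahler :: "nat \<Rightarrow> ((nat \<Rightarrow> complex) \<Rightarrow> complex) list \<Rightarrow> real" where
  "multiple_mahler n Ps =
     integral\<^sup>L (PiM {..<n} (\<lambda>_. restrict_space lborel {0..1::real}))
       (\<lambda>t. prod_list (map (\<lambda>P. ln (cmod (P (\<lambda>i. exp (2 * pi * \<i> * complex_of_real (t i)))))) Ps))"

end

theory Submission
  imports Defs "HOL-Complex_Analysis.Complex_Analysis"
begin

text \<open>
  For fixed \<open>x\<close> the integrand is a product of functions of the disjoint pairs \<open>(y\<^sub>j, z\<^sub>j)\<close>, so by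
  Fubini the multiple Mahler measure is the integral over \<open>x\<close> of \<open>F(x)\<^sup>k\<close>, where \<open>F(x)\<close> is the
  Mahler measure of \<open>1 + x + y + z\<close> in \<open>y\<close> and \<open>z\<close>. Jensen's formula in \<open>z\<close> reduces \<open>F(x)\<close> to the
  mean of \<open>ln (max 1 \<bar>1 + x + y\<bar>)\<close> over the circle, which depends only on
  \<open>\<bar>1 + x\<bar> = 2 sin (\<theta>/2)\<close>. Writing this function as the integral of its derivative in \<open>\<theta>\<close> and
  exchanging the integrals, the integral over \<open>y\<close> becomes elementary (an arctangent), and what
  remains is \<open>(1/\<pi>)\<close> times the integral of \<open>(t/2) cot (t/2)\<close> over \<open>[0, \<theta>]\<close>. Since the derivative
  of \<open>Cl2\<close> is \<open>-ln (2 sin (\<theta>/2))\<close>, an antiderivative of the latter is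
  \<open>\<theta> ln (2 sin (\<theta>/2)) + Cl2 \<theta>\<close>. Finally \<open>x = exp (2\<pi>it)\<close> gives \<open>\<theta> = \<bar>\<pi> - 2\<pi>t\<bar>\<close>.
\<close>

subsection \<open>Jensen's formula\<close>

abbreviation expi :: "real \<Rightarrow> complex" where
  "expi t \<equiv> exp (2 * complex_of_real pi * \<i> * complex_of_real t)"

lemma cmod_expi [simp]: "cmod (expi t) = 1"
  by simp

lemma expi_add: "expi (s + t) = expi s * expi t"
  by (simp add: algebra_simps flip: exp_add)

lemma expi_ne_minus_AE: "AE u in lborel. expi u \<noteq> w"
proof (cases "\<exists>u0. expi u0 = w")
  case True
  then obtain u0 where u0: "expi u0 = w" by blast
  have "{u. expi u = w} \<subseteq> range (\<lambda>n::int. u0 + of_int n)"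
  proof
    fix u assume "u \<in> {u. expi u = w}"
    then have "expi u = expi u0" using u0 by simp
    then obtain n :: int where
      "2 * complex_of_real pi * \<i> * of_real u = 2 * complex_of_real pi * \<i> * of_real u0 + of_real (of_int (2 * n) * pi) * \<i>"
      unfolding exp_eq by blast
    then have "Im (2 * complex_of_real pi * \<i> * of_real u) = Im (2 * complex_of_real pi * \<i> * of_real u0 + of_real (of_int (2 * n) * pi) * \<i>)"
      by (rule arg_cong)
    then have "2 * pi * u = 2 * pi * (u0 + of_int n)"
      by (simp add: algebra_simps)
    then have "u = u0 + of_int n" by simp
    then show "u \<in> range (\<lambda>n::int. u0 + of_int n)" by blast
  qed
  then have "countable {u. expi u = w}"
    by (rule countable_subset) simp
  then have "{u. expi u = w} \<in> null_sets lborel"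
    by (rule countable_imp_null_set_lborel)
  then show ?thesis
    by (rule AE_I') auto
next
  case False
  then show ?thesis by auto
qed

abbreviation interval_measure :: "real \<Rightarrow> real \<Rightarrow> real measure" where
  "interval_measure a b \<equiv> restrict_space lborel {a..b}"

abbreviation unit_interval :: "real measure" where
  "unit_interval \<equiv> interval_measure 0 1"

lemma has_integral_interval_measure:
  fixes f :: "real \<Rightarrow> real"
  assumes "integrable (interval_measure a b) f"
  shows "(f has_integral (LINT x|interval_measure a b. f x)) {a..b}"
proof -
  have "set_integrable lborel {a..b} f"
    using assms by (simp add: integrable_restrict_space set_integrable_def)
  from set_borel_integral_eq_integral[OF this] show ?thesis
    by (simp add: integral_restrict_space set_lebesgue_integral_def has_integral_integral)
qed

lemma integrable_interval_measure_continuous: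
  fixes f :: "real \<Rightarrow> real"
  assumes "continuous_on {a..b} f"
  shows "integrable (interval_measure a b) f"
  using borel_integrable_atLeastAtMost'[OF assms]
  by (simp add: integrable_restrict_space set_integrable_def)

lemma finite_measure_interval: "finite_measure (interval_measure a b)"
  by (rule finite_measureI)
     (cases "a \<le> b"; simp add: emeasure_restrict_space space_restrict_space)

lemma measure_unit_interval [simp]: "measure unit_interval {0..1} = 1"
  by (simp add: measure_restrict_space)

lemma Jensen_small:
  assumes "cmod b < 1"
  shows "((\<lambda>u. ln (cmod (1 + b * expi u))) has_integral 0) {0..1}"
proof -
  let ?f = "\<lambda>z. Ln (1 + b * z)"
  have pos: "Re (1 + b * z) > 0" if "cmod z \<le> 1" for z
  proof -
    have "cmod (b * z) < 1"
      using assms that by (metis mult_left_le norm_ge_zero norm_mult order_le_less_trans)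
    then have "Re (b * z) > -1"
      using abs_Re_le_cmod[of "b * z"] by linarith
    then show ?thesis by simp
  qed
  have nonpos: "1 + b * z \<notin> \<real>\<^sub>\<le>\<^sub>0" if "cmod z \<le> 1" for z
    using pos[OF that] by (auto simp: complex_nonpos_Reals_iff)
  have "((\<lambda>u. ?f u / (u - 0)) has_contour_integral 2 * of_real pi * \<i> * ?f 0) (circlepath 0 1)"
    by (rule Cauchy_integral_circlepath)
       (auto intro!: continuous_intros holomorphic_intros nonpos)
  then have "((\<lambda>t. 2 * of_real pi * \<i> * ?f (expi t)) has_integral 0) {0..1}"
    unfolding has_contour_integral_def
    by (rule has_integral_eq[rotated, THEN has_integral_eq_rhs])
       (auto simp: vector_derivative_circlepath01, auto simp: circlepath)
  then have "((\<lambda>t. (1 / (2 * of_real pi * \<i>)) * (2 * of_real pi * \<i> * ?f (expi t))) has_integral (1 / (2 * of_real pi * \<i>)) * 0) {0..1}"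
    by (rule has_integral_mult_right)
  then have "((\<lambda>t. ?f (expi t)) has_integral 0) {0..1}"
    by simp
  then have "((\<lambda>t. Re (?f (expi t))) has_integral 0) {0..1}"
    by (rule has_integral_Re[THEN has_integral_eq_rhs]) simp
  moreover have "Re (?f (expi t)) = ln (cmod (1 + b * expi t))" for t
    using pos[of "expi t"] by (metis Re_Ln cmod_expi less_irrefl order_refl zero_complex.sel(1))
  ultimately show ?thesis by simp
qed

lemma Jensen_ne_1:
  assumes "cmod a \<noteq> 1"
  shows "integrable unit_interval (\<lambda>u. ln (cmod (a + expi u)))"
    and "(LINT u|unit_interval. ln (cmod (a + expi u))) = ln (max 1 (cmod a))"
proof -
  have ne: "a + expi u \<noteq> 0" for u
  proof
    assume "a + expi u = 0"
    then have "a = - expi u" by (simp add: eq_neg_iff_add_eq_0)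
    then have "cmod a = cmod (expi u)" by (simp only: norm_minus_cancel)
    with assms show False by simp
  qed
  show int: "integrable unit_interval (\<lambda>u. ln (cmod (a + expi u)))"
    by (rule integrable_interval_measure_continuous) (intro continuous_intros ballI, simp add: ne)
  have "((\<lambda>u. ln (cmod (a + expi u))) has_integral ln (max 1 (cmod a))) {0..1}"
  proof (cases "cmod a < 1")
    case True
    have "cmod (1 + cnj a * expi u) = cmod (a + expi u)" for u
    proof -
      have "cnj (expi u) * expi u = 1"
        by (simp only: exp_cnj exp_add[symmetric]) simp
      then have "1 + cnj a * expi u = expi u * cnj (a + expi u)"
        by (simp add: algebra_simps)
      then show ?thesis
        by (simp only: norm_mult complex_mod_cnj cmod_expi mult_1)
    qed
    then show ?thesis
      using Jensen_small[of "cnj a"] True by simp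
  next
    case False
    with assms have gt: "cmod a > 1" by simp
    then have a0: "a \<noteq> 0" by auto
    have ne': "1 + inverse a * expi u \<noteq> 0" for u
      using ne[of u] a0 by (auto simp: field_simps)
    have "a + expi u = a * (1 + inverse a * expi u)" for u
    proof -
      have "a * (inverse a * expi u) = expi u" for u
        by (simp only: mult.assoc[symmetric] right_inverse[OF a0] mult_1)
      then show ?thesis by (simp only: distrib_left mult_1_right)
    qed
    then have "cmod (a + expi u) = cmod a * cmod (1 + inverse a * expi u)" for u
      by (simp only: norm_mult)
    then have "ln (cmod (a + expi u)) = ln (cmod a) + ln (cmod (1 + inverse a * expi u))" for u
      using a0 ne'[of u] by (simp add: ln_mult)
    moreover have "((\<lambda>u. ln (cmod (1 + inverse a * expi u))) has_integral 0) {0..1}"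
      by (rule Jensen_small) (use gt in \<open>simp add: norm_inverse inverse_less_1_iff\<close>)
    ultimately show ?thesis
      using has_integral_add[OF has_integral_const_real[of "ln (cmod a)" 0 1], of _ 0] gt
      by (simp add: max_def)
  qed
  then show "(LINT u|unit_interval. ln (cmod (a + expi u))) = ln (max 1 (cmod a))"
    by (rule has_integral_unique[OF has_integral_interval_measure[OF int]])
qed

text \<open>The bound \<open>\<bar>a + w\<bar> \<le> 2 * \<bar>r * a + w\<bar>\<close>, valid for \<open>\<bar>w\<bar> = 1\<close> and
  \<open>0 \<le> r \<le> 1\<close>, dominates the passage to the limit \<open>r \<longrightarrow> 1\<close>; Fatou's lemma
  supplies the integrability of the dominating function.\<close>

lemma Jensen_1:
  assumes "cmod a = 1"
  shows "integrable unit_interval (\<lambda>u. ln (cmod (a + expi u)))"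
    and "(LINT u|unit_interval. ln (cmod (a + expi u))) = 0"
proof -
  interpret U: finite_measure unit_interval by (rule finite_measure_interval)
  define r :: "nat \<Rightarrow> real" where "r n = 1 - inverse (real (Suc (Suc n)))" for n
  have r: "0 < r n" "r n < 1" for n
    by (auto simp: r_def field_simps)
  have r_lim: "r \<longlonglongrightarrow> 1"
    unfolding r_def by real_asymp
  define K where "K n u = ln 2 - ln (cmod (of_real (r n) * a + expi u))" for n u
  define L where "L u = ln 2 - ln (cmod (a + expi u))" for u
  have ra: "cmod (of_real (r n) * a) = r n" for n
    using r[of n] assms by (simp add: norm_mult)
  have K_int: "integrable unit_interval (K n)" and K_val: "(LINT u|unit_interval. K n u) = ln 2" for n
    using Jensen_ne_1[of "of_real (r n) * a"] ra[of n] r[of n]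
    unfolding K_def by (auto simp: space_restrict_space)
  have low: "1 - r n \<le> cmod (of_real (r n) * a + expi u)" for n u
    using norm_diff_ineq[of "expi u" "of_real (r n) * a"] ra[of n] by (simp add: add.commute)
  have pos: "cmod (of_real (r n) * a + expi u) > 0" for n u
    using low[of n u] r[of n] by linarith
  have le2: "cmod (of_real (r n) * a + expi u) \<le> 2" for n u
    using norm_triangle_ineq[of "of_real (r n) * a" "expi u"] ra[of n] r[of n] by simp
  have K_nonneg: "0 \<le> K n u" for n u
    using pos[of n u] le2[of n u] by (simp add: K_def)
  have half: "cmod (a + expi u) \<le> 2 * cmod (of_real (r n) * a + expi u)" for n u
  proof -
    have "a + expi u = (of_real (r n) * a + expi u) + of_real (1 - r n) * a"
      by (simp add: algebra_simps)
    then have "cmod (a + expi u) \<le> cmod (of_real (r n) * a + expi u) + cmod (of_real (1 - r n) * a)"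
      by (simp only: norm_triangle_ineq)
    also have "cmod (of_real (1 - r n) * a) = 1 - r n"
      using r[of n] assms by (simp add: norm_mult del: of_real_diff)
    also note low[of n u]
    finally show ?thesis by simp
  qed
  have AE_ne: "AE u in unit_interval. a + expi u \<noteq> 0"
    using expi_ne_minus_AE[of "- a"]
    by (subst AE_restrict_space_iff) (auto simp: add_eq_0_iff elim!: eventually_mono)
  have K_le: "K n u \<le> L u + ln 2" if "a + expi u \<noteq> 0" for n u
  proof -
    have "ln (cmod (a + expi u)) \<le> ln (2 * cmod (of_real (r n) * a + expi u))"
      using half[of u n] that pos[of n u] by (subst ln_le_cancel_iff) auto
    then show ?thesis
      using pos[of n u] by (simp add: K_def L_def ln_mult)
  qed
  have lim: "(\<lambda>n. K n u) \<longlonglongrightarrow> L u" if "a + expi u \<noteq> 0" for u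
  proof -
    have "(\<lambda>n. K n u) \<longlonglongrightarrow> ln 2 - ln (cmod (of_real 1 * a + expi u))"
      unfolding K_def by (intro tendsto_intros r_lim) (use that in auto)
    then show ?thesis by (simp add: L_def)
  qed
  have L_meas: "L \<in> borel_measurable unit_interval"
    unfolding L_def by (intro measurable_restrict_space1) measurable
  have L_nonneg: "0 \<le> L u" for u
  proof (cases "a + expi u = 0")
    case True
    then show ?thesis by (simp add: L_def)
  next
    case False
    moreover have "cmod (a + expi u) \<le> 2"
      using norm_triangle_ineq[of a "expi u"] assms by simp
    ultimately show ?thesis by (simp add: L_def)
  qed
  have "(\<integral>\<^sup>+u. ennreal (L u) \<partial>unit_interval) = (\<integral>\<^sup>+u. liminf (\<lambda>n. ennreal (K n u)) \<partial>unit_interval)"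
    using AE_ne
    by (intro nn_integral_cong_AE, elim eventually_mono)
       (auto intro!: lim_imp_Liminf[symmetric] tendsto_ennrealI lim)
  also have "\<dots> \<le> liminf (\<lambda>n. \<integral>\<^sup>+u. ennreal (K n u) \<partial>unit_interval)"
    by (rule nn_integral_liminf) (use borel_measurable_integrable[OF K_int] in measurable)
  also have "(\<lambda>n. \<integral>\<^sup>+u. ennreal (K n u) \<partial>unit_interval) = (\<lambda>n. ennreal (ln 2))"
    by (subst nn_integral_eq_integral) (auto simp: K_int K_nonneg K_val)
  finally have "(\<integral>\<^sup>+u. ennreal (L u) \<partial>unit_interval) < \<infinity>"
    by (simp add: Liminf_const order_le_less_trans)
  then have L_int: "integrable unit_interval L"
    by (intro integrableI_nonneg L_meas) (auto simp: L_nonneg)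
  have "(\<lambda>n. LINT u|unit_interval. K n u) \<longlonglongrightarrow> (LINT u|unit_interval. L u)"
  proof (rule integral_dominated_convergence)
    show "integrable unit_interval (\<lambda>u. L u + ln 2)" using L_int by auto
    show "AE u in unit_interval. (\<lambda>n. K n u) \<longlonglongrightarrow> L u"
      using AE_ne by eventually_elim (rule lim)
    show "AE u in unit_interval. norm (K n u) \<le> L u + ln 2" for n
      using AE_ne by eventually_elim (use K_le K_nonneg in auto)
  qed (use L_meas borel_measurable_integrable[OF K_int] in auto)
  then have L_val: "(LINT u|unit_interval. L u) = ln 2"
    unfolding K_val by (simp add: LIMSEQ_const_iff)
  have eq: "ln (cmod (a + expi u)) = ln 2 - L u" for u by (simp add: L_def)
  show "integrable unit_interval (\<lambda>u. ln (cmod (a + expi u)))"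
    unfolding eq using L_int by auto
  show "(LINT u|unit_interval. ln (cmod (a + expi u))) = 0"
    unfolding eq using L_int by (simp add: L_val space_restrict_space)
qed

lemma Jensen:
  shows integrable_ln_cmod: "integrable unit_interval (\<lambda>u. ln (cmod (a + expi u)))"
    and integral_ln_cmod: "(LINT u|unit_interval. ln (cmod (a + expi u))) = ln (max 1 (cmod a))"
  by (cases "cmod a = 1", (rule Jensen_1 Jensen_ne_1, assumption)+)
     (cases "cmod a = 1", simp only: Jensen_1 max.idem ln_one, rule Jensen_ne_1)

lemma integral_abs_ln_cmod_le:
  assumes "cmod a \<le> R"
  shows "(LINT u|unit_interval. \<bar>ln (cmod (a + expi u))\<bar>) \<le> 2 * ln (R + 1)"
proof -
  interpret U: finite_measure unit_interval by (rule finite_measure_interval)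
  have R: "0 \<le> R" using assms norm_ge_zero order_trans by blast
  have eq: "\<bar>ln (cmod (a + expi u))\<bar> = 2 * ln (max 1 (cmod (a + expi u))) - ln (cmod (a + expi u))" for u
  proof (cases "a + expi u = 0")
    case False
    then show ?thesis by (auto simp: max_def abs_if ln_ge_zero)
  qed simp
  have "max 1 (cmod (a + expi u)) \<le> R + 1" for u
    using norm_triangle_ineq[of a "expi u"] assms R by simp
  then have "\<bar>ln (cmod (a + expi u))\<bar> \<le> 2 * ln (R + 1) - ln (cmod (a + expi u))" for u
    unfolding eq using ln_le_cancel_iff[of "max 1 (cmod (a + expi u))" "R + 1" for u] R
    by (smt (verit))
  then have "(LINT u|unit_interval. \<bar>ln (cmod (a + expi u))\<bar>) \<le> (LINT u|unit_interval. 2 * ln (R + 1) - ln (cmod (a + expi u)))"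
    by (intro integral_mono integrable_abs Bochner_Integration.integrable_diff integrable_ln_cmod) auto
  also have "\<dots> = 2 * ln (R + 1) - ln (max 1 (cmod a))"
    by (subst Bochner_Integration.integral_diff) (auto simp: integral_ln_cmod integrable_ln_cmod space_restrict_space)
  also have "\<dots> \<le> 2 * ln (R + 1)" by simp
  finally show ?thesis .
qed

subsection \<open>The Clausen function\<close>

lemma cos_less_1:
  fixes x :: real
  assumes "0 < x" "x < 2 * pi"
  shows "cos x < 1"
proof -
  have "sin (x / 2) > 0" using assms by (intro sin_gt_zero) auto
  then show ?thesis using cos_double_sin[of "x / 2"] by simp
qed

lemma quadratic_cos_pos:
  fixes r x :: real
  assumes "0 \<le> r" "r < 1 \<or> 0 < x \<and> x < 2 * pi"
  shows "0 < 1 - 2 * r * cos x + r\<^sup>2"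
proof -
  have eq: "1 - 2 * r * cos x + r\<^sup>2 = (1 - r)\<^sup>2 + 2 * r * (1 - cos x)"
    by (simp add: power2_eq_square algebra_simps)
  show ?thesis
  proof (cases "r < 1")
    case True
    then show ?thesis
      unfolding eq using assms(1) by (intro add_pos_nonneg) auto
  next
    case False
    then show ?thesis
      unfolding eq using assms cos_less_1[of x] by (intro add_nonneg_pos) auto
  qed
qed

lemma sums_cos_over_n:
  fixes r x :: real
  assumes "0 \<le> r" "r < 1"
  shows "(\<lambda>n. r ^ Suc n * cos (real (Suc n) * x) / real (Suc n)) sums
           (- (ln (1 - 2 * r * cos x + r\<^sup>2) / 2))"
proof -
  let ?z = "of_real r * cis x"
  have "(\<lambda>n. - ((- (- ?z)) ^ n) / of_nat n) sums ln (1 + (- ?z))"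
    using assms by (intro Ln_series') (simp add: norm_mult)
  then have "(\<lambda>n. Re (- (?z ^ n) / of_nat n)) sums Re (ln (1 - ?z))"
    by (intro sums_Re) simp
  moreover have "Re (- (?z ^ n) / of_nat n) = - (r ^ n * cos (real n * x) / real n)" for n
  proof -
    have "?z ^ n = of_real (r ^ n) * cis (real n * x)"
      by (simp only: power_mult_distrib Complex.DeMoivre of_real_power)
    then show ?thesis
      by (simp only: Re_divide_of_nat uminus_complex.sel Re_complex_of_real times_complex.sel
          Im_complex_of_real cis.sel) simp
  qed
  moreover have "Re (ln (1 - ?z)) = ln (1 - 2 * r * cos x + r\<^sup>2) / 2"
  proof -
    have "(cmod (1 - ?z))\<^sup>2 = 1 - 2 * r * cos x + r\<^sup>2 * ((sin x)\<^sup>2 + (cos x)\<^sup>2)"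
      unfolding cmod_power2 by (simp add: power2_eq_square algebra_simps del: sin_cos_squared_add sin_cos_squared_add2 sin_cos_squared_add3)
    then have eq: "(cmod (1 - ?z))\<^sup>2 = 1 - 2 * r * cos x + r\<^sup>2"
      by simp
    then have "cmod (1 - ?z) > 0"
      using quadratic_cos_pos[of r x] assms by auto
    moreover from this have "ln ((cmod (1 - ?z))\<^sup>2) = 2 * ln (cmod (1 - ?z))"
      by (simp add: ln_realpow)
    ultimately show ?thesis
      unfolding eq by (subst Re_Ln) auto
  qed
  ultimately have "(\<lambda>n. - (r ^ n * cos (real n * x) / real n)) sums (ln (1 - 2 * r * cos x + r\<^sup>2) / 2)"
    by (simp only:)
  from sums_minus[OF this] have "(\<lambda>n. r ^ n * cos (real n * x) / real n) sums (- (ln (1 - 2 * r * cos x + r\<^sup>2) / 2))"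
    by simp
  then show ?thesis
    by (subst sums_Suc_iff) simp
qed

text \<open>The series of \<open>Cl2\<close> cannot be differentiated termwise (the derived series converges
  only conditionally), so it is replaced by its Abel means.\<close>

definition Clausen_mean :: "real \<Rightarrow> real \<Rightarrow> real" where
  "Clausen_mean r \<theta> = (\<Sum>n. r ^ Suc n * sin (real (Suc n) * \<theta>) / (real (Suc n))\<^sup>2)"

lemma Clausen_mean_1: "Clausen_mean 1 = Cl2"
  by (rule ext) (simp add: Clausen_mean_def Cl2_def)

lemma Clausen_term_le:
  assumes "0 \<le> r" "r \<le> 1"
  shows "norm (r ^ Suc n * sin (real (Suc n) * \<theta>) / (real (Suc n))\<^sup>2) \<le> 1 / (real (Suc n))\<^sup>2"
proof -
  have "r ^ Suc n * \<bar>sin (real (Suc n) * \<theta>)\<bar> \<le> 1 * 1"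
    using assms by (intro mult_mono power_le_one) auto
  then show ?thesis
    using assms by (simp add: abs_mult divide_right_mono del: power_Suc of_nat_Suc)
qed

lemma summable_inverse_Suc_squares: "summable (\<lambda>n. 1 / (real (Suc n))\<^sup>2)"
  using inverse_squares_sums by (simp add: sums_iff add.commute)

lemma continuous_on_Clausen_mean:
  "continuous_on ({0..1} \<times> UNIV) (\<lambda>(r, \<theta>). Clausen_mean r \<theta>)"
proof -
  let ?f = "\<lambda>n p. fst p ^ Suc n * sin (real (Suc n) * snd p) / (real (Suc n))\<^sup>2"
  have "uniform_limit ({0..1} \<times> UNIV) (\<lambda>n p. \<Sum>i<n. ?f i p) (\<lambda>p. \<Sum>i. ?f i p) sequentially"
    by (rule Weierstrass_m_test[OF _ summable_inverse_Suc_squares])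
       (rule Clausen_term_le, auto)
  then have "continuous_on ({0..1} \<times> UNIV) (\<lambda>p. \<Sum>i. ?f i p)"
    by (rule uniform_limit_theorem[rotated])
       (auto intro!: continuous_intros always_eventually simp del: of_nat_Suc)
  then show ?thesis
    by (simp add: Clausen_mean_def case_prod_unfold)
qed

lemma continuous_on_Cl2: "continuous_on A Cl2"
proof -
  have "continuous_on A (\<lambda>\<theta>. (\<lambda>(r, \<theta>). Clausen_mean r \<theta>) (1, \<theta>))"
    by (rule continuous_on_compose2[OF continuous_on_Clausen_mean])
       (auto intro!: continuous_intros)
  then show ?thesis by (simp add: Clausen_mean_1)
qed

lemma Clausen_mean_has_derivative:
  assumes "0 \<le> r" "r < 1"
  shows "(Clausen_mean r has_real_derivative - (ln (1 - 2 * r * cos \<theta> + r\<^sup>2) / 2)) (at \<theta>)"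
proof -
  have "((\<lambda>\<theta>. \<Sum>n. r ^ Suc n * sin (real (Suc n) * \<theta>) / (real (Suc n))\<^sup>2) has_real_derivative
          (\<Sum>n. r ^ Suc n * cos (real (Suc n) * \<theta>) / real (Suc n))) (at \<theta>)"
  proof (rule has_field_derivative_series'(2)[where S = UNIV and ?x0.0 = 0 and
          f = "\<lambda>n \<theta>. r ^ Suc n * sin (real (Suc n) * \<theta>) / (real (Suc n))\<^sup>2" and
          f' = "\<lambda>n \<theta>. r ^ Suc n * cos (real (Suc n) * \<theta>) / real (Suc n)"])
    show "((\<lambda>\<theta>. r ^ Suc n * sin (real (Suc n) * \<theta>) / (real (Suc n))\<^sup>2) has_real_derivative
            r ^ Suc n * cos (real (Suc n) * x) / real (Suc n)) (at x within UNIV)" for n x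
      by (rule derivative_eq_intros refl | simp add: power2_eq_square del: of_nat_Suc power_Suc)+
    show "uniformly_convergent_on UNIV (\<lambda>n x. \<Sum>i<n. r ^ Suc i * cos (real (Suc i) * x) / real (Suc i))"
    proof (rule Weierstrass_m_test')
      fix n and x :: real
      have "r ^ Suc n * \<bar>cos (real (Suc n) * x)\<bar> / real (Suc n) \<le> r ^ Suc n * 1 / 1"
        using assms by (intro frac_le mult_left_mono) auto
      then show "norm (r ^ Suc n * cos (real (Suc n) * x) / real (Suc n)) \<le> r ^ Suc n"
        using assms by (simp add: abs_mult del: of_nat_Suc power_Suc)
      show "summable (\<lambda>n. r ^ Suc n)"
        using assms by (simp add: summable_mult summable_geometric)
    qed
  qed auto
  also have "(\<Sum>n. r ^ Suc n * cos (real (Suc n) * \<theta>) / real (Suc n)) = - (ln (1 - 2 * r * cos \<theta> + r\<^sup>2) / 2)"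
    using sums_cos_over_n[OF assms] by (rule sums_unique[symmetric])
  finally show ?thesis
    by (simp add: Clausen_mean_def[abs_def])
qed

lemma Cl2_diff_eq_integral:
  assumes "0 < a" "a \<le> b" "b < 2 * pi"
  shows "Cl2 b - Cl2 a = integral {a..b} (\<lambda>x. - ln (2 * sin (x / 2)))"
proof -
  let ?g = "\<lambda>r x. - (ln (1 - 2 * r * cos x + r\<^sup>2) / 2)"
  define D where "D r = Clausen_mean r b - Clausen_mean r a - integral (cbox a b) (?g r)" for r
  have "continuous_on {0..1} (\<lambda>r. Clausen_mean r \<theta>)" for \<theta>
  proof -
    have "continuous_on {0..1} (\<lambda>r. (\<lambda>(r, \<theta>). Clausen_mean r \<theta>) (r, \<theta>))"
      by (rule continuous_on_compose2[OF continuous_on_Clausen_mean])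
         (auto intro!: continuous_intros)
    then show ?thesis by simp
  qed
  moreover have "continuous_on {0..1} (\<lambda>r. integral (cbox a b) (?g r))"
  proof (rule integral_continuous_on_param)
    have "1 - 2 * r * cos x + r\<^sup>2 \<noteq> 0" if "0 \<le> r" "a \<le> x" "x \<le> b" for r x
      using quadratic_cos_pos[of r x] that assms by auto
    then show "continuous_on ({0..1} \<times> cbox a b) (\<lambda>(r, x). ?g r x)"
      by (auto intro!: continuous_intros simp: case_prod_unfold)
  qed
  ultimately have "continuous_on {0..1} D"
    unfolding D_def by (intro continuous_intros)
  then have "continuous_on (closure {0..<1}) D" by simp
  moreover have "D r = 0" if "r \<in> {0..<1}" for r
  proof -
    have "(?g r has_integral (Clausen_mean r b - Clausen_mean r a)) {a..b}"
    proof (rule fundamental_theorem_of_calculus)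
      fix x
      have "(Clausen_mean r has_real_derivative ?g r x) (at x within {a..b})"
        by (rule has_field_derivative_at_within, rule Clausen_mean_has_derivative) (use that in auto)
      then show "(Clausen_mean r has_vector_derivative ?g r x) (at x within {a..b})"
        by (simp only: has_real_derivative_iff_has_vector_derivative)
    qed (use assms in simp)
    from integral_unique[OF this] show ?thesis
      by (simp only: D_def cbox_interval diff_self)
  qed
  ultimately have "D 1 = 0"
    by (rule continuous_constant_on_closure) auto
  moreover have "integral {a..b} (?g 1) = integral {a..b} (\<lambda>x. - ln (2 * sin (x / 2)))"
  proof (rule integral_cong)
    fix x assume x: "x \<in> {a..b}"
    have s: "sin (x / 2) > 0" using assms x by (intro sin_gt_zero) auto
    have "1 - 2 * 1 * cos x + 1\<^sup>2 = (2 * sin (x / 2))\<^sup>2"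
      using cos_double_sin[of "x / 2"] by (simp add: power2_eq_square)
    then show "?g 1 x = - ln (2 * sin (x / 2))"
      using s by (simp only: ln_realpow[of "2 * sin (x / 2)"])
  qed
  moreover have "D 1 = Cl2 b - Cl2 a - integral {a..b} (?g 1)"
    by (simp only: D_def cbox_interval Clausen_mean_1)
  ultimately show ?thesis
    by linarith
qed

lemma Cl2_has_derivative:
  assumes "0 < \<theta>" "\<theta> < 2 * pi"
  shows "(Cl2 has_real_derivative - ln (2 * sin (\<theta> / 2))) (at \<theta>)"
proof -
  define a b where "a = \<theta> / 2" and "b = (\<theta> + 2 * pi) / 2"
  have ab: "0 < a" "a < \<theta>" "\<theta> < b" "b < 2 * pi"
    using assms by (auto simp: a_def b_def)
  have "sin (x / 2) \<noteq> 0" if "x \<in> {a..b}" for x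
    using that ab sin_gt_zero[of "x / 2"] by auto
  then have "continuous_on {a..b} (\<lambda>x. - ln (2 * sin (x / 2)))"
    by (auto intro!: continuous_intros)
  from integral_has_real_derivative[OF this, of \<theta>]
  have "((\<lambda>x. integral {a..x} (\<lambda>x. - ln (2 * sin (x / 2)))) has_real_derivative
          - ln (2 * sin (\<theta> / 2))) (at \<theta> within {a<..<b})"
    using ab by (intro DERIV_subset[where s = "{a..b}" and t = "{a<..<b}"]) auto
  then have "((\<lambda>x. Cl2 a + integral {a..x} (\<lambda>x. - ln (2 * sin (x / 2)))) has_real_derivative
          - ln (2 * sin (\<theta> / 2))) (at \<theta> within {a<..<b})"
    by (rule DERIV_const[THEN DERIV_add, THEN DERIV_cong]) simp
  then have "(Cl2 has_real_derivative - ln (2 * sin (\<theta> / 2))) (at \<theta> within {a<..<b})"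
    by (rule has_field_derivative_transform_within[where d = 1])
       (use ab Cl2_diff_eq_integral[of a] in \<open>auto simp: algebra_simps\<close>)
  then show ?thesis
    using ab by (simp add: at_within_open[of \<theta> "{a<..<b}"])
qed

definition log_sine_Clausen :: "real \<Rightarrow> real" where
  "log_sine_Clausen \<theta> = \<theta> * ln (2 * sin (\<theta> / 2)) + Cl2 \<theta>"

lemma continuous_on_log_sine_Clausen: "continuous_on {0..pi} log_sine_Clausen"
proof -
  have "continuous_on {0..pi} (\<lambda>\<theta>. \<theta> * ln (2 * sin (\<theta> / 2)))"
    unfolding continuous_on_def
  proof
    fix x assume x: "x \<in> {0..pi}"
    show "((\<lambda>\<theta>. \<theta> * ln (2 * sin (\<theta> / 2))) \<longlongrightarrow> x * ln (2 * sin (x / 2))) (at x within {0..pi})"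
    proof (cases "x = 0")
      case True
      have "((\<lambda>\<theta>::real. \<theta> * ln (2 * sin (\<theta> / 2))) \<longlongrightarrow> 0) (at_right 0)"
        by real_asymp
      then show ?thesis
        using True by (simp add: at_within_Icc_at_right)
    next
      case False
      then have "sin (x / 2) > 0" using x by (intro sin_gt_zero) auto
      then show ?thesis by (auto intro!: tendsto_intros)
    qed
  qed
  then show ?thesis
    unfolding log_sine_Clausen_def[abs_def]
    by (intro continuous_on_add continuous_on_Cl2)
qed

lemma log_sine_Clausen_has_integral:
  assumes "0 \<le> \<theta>" "\<theta> \<le> pi"
  shows "((\<lambda>x. x * cos (x / 2) / (2 * sin (x / 2))) has_integral log_sine_Clausen \<theta>) {0..\<theta>}"
proof -
  have "((\<lambda>x. x * cos (x / 2) / (2 * sin (x / 2))) has_integral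
          (log_sine_Clausen \<theta> - log_sine_Clausen 0)) {0..\<theta>}"
  proof (rule fundamental_theorem_of_calculus_interior)
    show "continuous_on {0..\<theta>} log_sine_Clausen"
      by (rule continuous_on_subset[OF continuous_on_log_sine_Clausen]) (use assms in auto)
    fix x assume x: "x \<in> {0<..<\<theta>}"
    then have "sin (x / 2) > 0" using assms by (intro sin_gt_zero) auto
    moreover have "0 < x" "x < 2 * pi" using x assms by auto
    ultimately show "(log_sine_Clausen has_vector_derivative x * cos (x / 2) / (2 * sin (x / 2))) (at x)"
      unfolding log_sine_Clausen_def[abs_def] has_real_derivative_iff_has_vector_derivative[symmetric]
      by (auto intro!: derivative_eq_intros Cl2_has_derivative simp: field_simps)
  qed (use assms in auto)
  then show ?thesis by (simp add: log_sine_Clausen_def Cl2_def)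
qed

subsection \<open>The mean of the truncated logarithm\<close>

lemma integral_periodic_shift:
  fixes g :: "real \<Rightarrow> real"
  assumes cont: "continuous_on UNIV g" and per: "\<And>x. g (x + 1) = g x" and "0 \<le> c" "c \<le> 1"
  shows "integral {-c..1 - c} g = integral {0..1} g"
proof -
  have int: "g integrable_on {a..b}" for a b
    by (intro integrable_continuous_interval continuous_on_subset[OF cont]) auto
  have "integral {-c..1 - c} g = integral {-c..0} g + integral {0..1 - c} g"
    using assms by (intro Henstock_Kurzweil_Integration.integral_combine[symmetric] int) auto
  also have "integral {-c..0} g = integral {1 - c..1} g"
    using integral_shift_real_ivl[of "1 - c" 1 1 g] by (simp add: per)
  also have "integral {1 - c..1} g + integral {0..1 - c} g = integral {0..1} g"
    using assms by (subst add.commute, intro Henstock_Kurzweil_Integration.integral_combine int) auto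
  finally show ?thesis .
qed

lemma integral_swap_bounded:
  fixes f :: "real \<Rightarrow> real \<Rightarrow> real"
  assumes meas: "(\<lambda>p. f (fst p) (snd p)) \<in> borel_measurable (borel \<Otimes>\<^sub>M borel)"
    and bound: "\<And>x y. \<lbrakk>x \<in> {a..b}; y \<in> {c..d}\<rbrakk> \<Longrightarrow> \<bar>f x y\<bar> \<le> B"
  shows "integral {a..b} (\<lambda>x. integral {c..d} (f x)) = integral {c..d} (\<lambda>y. integral {a..b} (\<lambda>x. f x y))"
proof -
  let ?M = "interval_measure a b" and ?N = "interval_measure c d"
  interpret M: finite_measure ?M by (rule finite_measure_interval)
  interpret N: finite_measure ?N by (rule finite_measure_interval)
  interpret P: pair_sigma_finite ?M ?N ..
  interpret MN: finite_measure "?M \<Otimes>\<^sub>M ?N"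
    by (rule finite_measure_pair_measure) unfold_locales
  have f_meas [measurable]: "(\<lambda>p. f (fst p) (snd p)) \<in> borel_measurable (?M \<Otimes>\<^sub>M ?N)"
  proof -
    have "(\<lambda>p. p) \<in> (?M \<Otimes>\<^sub>M ?N) \<rightarrow>\<^sub>M (borel \<Otimes>\<^sub>M borel)"
      by (rule measurable_pair)
         (auto simp: comp_def intro!: measurable_compose[OF measurable_fst] measurable_compose[OF measurable_snd] measurable_restrict_space1)
    from measurable_compose[OF this meas] show ?thesis by simp
  qed
  have int: "integrable (?M \<Otimes>\<^sub>M ?N) (\<lambda>p. f (fst p) (snd p))"
    by (rule MN.integrable_const_bound[of _ B])
       (auto intro!: AE_I2 bound simp: space_pair_measure space_restrict_space)
  have x_int: "integrable ?N (f x)" if "x \<in> {a..b}" for x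
  proof (rule N.integrable_const_bound[of _ B])
    have "(\<lambda>y. (x, y)) \<in> ?N \<rightarrow>\<^sub>M ?M \<Otimes>\<^sub>M ?N"
      using that by (intro measurable_Pair1') (simp add: space_restrict_space)
    from measurable_compose[OF this f_meas] show "f x \<in> borel_measurable ?N"
      by simp
  qed (use that bound in \<open>auto intro!: AE_I2 simp: space_restrict_space\<close>)
  have y_int: "integrable ?M (\<lambda>x. f x y)" if "y \<in> {c..d}" for y
  proof (rule M.integrable_const_bound[of _ B])
    have "(\<lambda>x. (x, y)) \<in> ?M \<rightarrow>\<^sub>M ?M \<Otimes>\<^sub>M ?N"
      using that by (intro measurable_Pair2') (simp add: space_restrict_space)
    from measurable_compose[OF this f_meas] show "(\<lambda>x. f x y) \<in> borel_measurable ?M"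
      by simp
  qed (use that bound in \<open>auto intro!: AE_I2 simp: space_restrict_space\<close>)
  have int': "integrable (?M \<Otimes>\<^sub>M ?N) (case_prod f)"
    using int by (simp add: case_prod_unfold)
  have "integral {a..b} (\<lambda>x. integral {c..d} (f x)) = integral {a..b} (\<lambda>x. LINT y|?N. f x y)"
    using x_int by (intro integral_cong integral_unique has_integral_interval_measure)
  also have "\<dots> = (LINT x|?M. LINT y|?N. f x y)"
    using P.integrable_fst'[OF int] by (intro integral_unique has_integral_interval_measure) simp
  also have "\<dots> = (LINT y|?N. LINT x|?M. f x y)"
    by (rule P.Fubini_integral[OF int', symmetric])
  also have "\<dots> = integral {c..d} (\<lambda>y. LINT x|?M. f x y)"
    using P.integrable_snd[OF int']
    by (intro integral_unique[symmetric] has_integral_interval_measure) simp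
  also have "\<dots> = integral {c..d} (\<lambda>y. integral {a..b} (\<lambda>x. f x y))"
    using y_int by (intro integral_cong integral_unique[symmetric] has_integral_interval_measure)
  finally show ?thesis .
qed

definition shifted_norm_sq :: "real \<Rightarrow> real \<Rightarrow> real" where
  "shifted_norm_sq x s = 1 + 4 * (sin (x / 2))\<^sup>2 + 4 * sin (x / 2) * cos (2 * pi * s)"

lemma cmod_add_expi_sq: "(cmod (of_real (2 * sin (x / 2)) + expi s))\<^sup>2 = shifted_norm_sq x s"
proof -
  have "expi s = cis (2 * pi * s)"
    by (simp add: cis_conv_exp mult_ac)
  then have "(cmod (of_real (2 * sin (x / 2)) + expi s))\<^sup>2
      = (2 * sin (x / 2) + cos (2 * pi * s))\<^sup>2 + (sin (2 * pi * s))\<^sup>2"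
    by (simp add: cmod_power2)
  also have "\<dots> = shifted_norm_sq x s + ((sin (2 * pi * s))\<^sup>2 + (cos (2 * pi * s))\<^sup>2 - 1)"
    unfolding shifted_norm_sq_def by (simp add: power2_eq_square algebra_simps del: sin_cos_squared_add sin_cos_squared_add2 sin_cos_squared_add3)
  finally show ?thesis by simp
qed

lemma ln_max_cmod_add_expi:
  "ln (max 1 (cmod (of_real (2 * sin (x / 2)) + expi s))) = ln (max 1 (shifted_norm_sq x s)) / 2"
proof -
  let ?r = "cmod (of_real (2 * sin (x / 2)) + expi s)"
  have "max 1 (?r\<^sup>2) = (max 1 ?r)\<^sup>2"
    using abs_le_square_iff[of 1 ?r] by (auto simp: max_def)
  then have "ln (max 1 (?r\<^sup>2)) = 2 * ln (max 1 ?r)"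
    by (simp add: ln_realpow)
  then show ?thesis by (simp only: cmod_add_expi_sq)
qed

lemma sin_add_cos_nonneg_iff:
  assumes "0 \<le> x" "x \<le> pi" "\<bar>s\<bar> \<le> 1 / 2"
  shows "0 \<le> sin (x / 2) + cos (2 * pi * s) \<longleftrightarrow> 4 * pi * \<bar>s\<bar> - pi \<le> x"
proof -
  have "2 * pi * \<bar>s\<bar> \<le> 2 * pi * (1 / 2)"
    using assms by (intro mult_left_mono) auto
  then have s: "0 \<le> 2 * pi * \<bar>s\<bar>" "2 * pi * \<bar>s\<bar> \<le> pi" by auto
  have "cos (2 * pi * s) = cos (2 * pi * \<bar>s\<bar>)"
    by (cases "s \<ge> 0") auto
  also have "\<dots> = - sin (2 * pi * \<bar>s\<bar> - pi / 2)"
    by (simp add: sin_diff)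
  finally have "0 \<le> sin (x / 2) + cos (2 * pi * s) \<longleftrightarrow> sin (2 * pi * \<bar>s\<bar> - pi / 2) \<le> sin (x / 2)"
    by linarith
  also have "\<dots> \<longleftrightarrow> 2 * pi * \<bar>s\<bar> - pi / 2 \<le> x / 2"
    using assms s by (intro sin_mono_le_eq) auto
  finally show ?thesis by (auto simp: field_simps)
qed

lemma shifted_norm_sq_ge_1_iff:
  assumes "0 < x" "x \<le> pi" "\<bar>s\<bar> \<le> 1 / 2"
  shows "1 \<le> shifted_norm_sq x s \<longleftrightarrow> 4 * pi * \<bar>s\<bar> - pi \<le> x"
proof -
  have "sin (x / 2) > 0" using assms by (intro sin_gt_zero) auto
  moreover have "shifted_norm_sq x s = 1 + 4 * sin (x / 2) * (sin (x / 2) + cos (2 * pi * s))"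
    by (simp add: shifted_norm_sq_def power2_eq_square algebra_simps)
  ultimately have "1 \<le> shifted_norm_sq x s \<longleftrightarrow> 0 \<le> sin (x / 2) + cos (2 * pi * s)"
    by (simp add: zero_le_mult_iff)
  then show ?thesis using sin_add_cos_nonneg_iff[of x s] assms by simp
qed

text \<open>The derivative in \<open>x\<close> of \<open>ln (max 1 \<bar>2 sin (x / 2) + expi s\<bar>)\<close>. With the radius
  written as \<open>2 sin (x / 2)\<close>, the region where the absolute value is at least 1 has a linear
  boundary.\<close>

definition log_kernel :: "real \<Rightarrow> real \<Rightarrow> real" where
  "log_kernel x s =
     (if 4 * pi * \<bar>s\<bar> - pi \<le> x
      then cos (x / 2) * (2 * sin (x / 2) + cos (2 * pi * s)) / shifted_norm_sq x s else 0)"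

lemma log_kernel_has_integral_x:
  assumes "0 \<le> \<theta>" "\<theta> \<le> pi" "\<bar>s\<bar> \<le> 1 / 2"
  shows "((\<lambda>x. log_kernel x s) has_integral ln (max 1 (shifted_norm_sq \<theta> s)) / 2) {0..\<theta>}"
proof -
  let ?F = "\<lambda>x. ln (max 1 (shifted_norm_sq x s)) / 2"
  have "((\<lambda>x. log_kernel x s) has_integral ?F \<theta> - ?F 0) {0..\<theta>}"
  proof (rule fundamental_theorem_of_calculus_interior_strong[where S = "{4 * pi * \<bar>s\<bar> - pi}"])
    show "continuous_on {0..\<theta>} ?F"
      unfolding shifted_norm_sq_def by (intro continuous_intros) auto
    fix x assume x: "x \<in> {0<..<\<theta>} - {4 * pi * \<bar>s\<bar> - pi}"
    show "(?F has_vector_derivative log_kernel x s) (at x)"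
    proof (cases "4 * pi * \<bar>s\<bar> - pi \<le> x")
      case True
      then have ge: "1 \<le> shifted_norm_sq x s"
        using x assms by (subst shifted_norm_sq_ge_1_iff) auto
      let ?D = "4 * sin (x / 2) * cos (x / 2) + 2 * cos (x / 2) * cos (2 * pi * s)"
      have "((\<lambda>x. shifted_norm_sq x s) has_real_derivative ?D) (at x)"
        unfolding shifted_norm_sq_def by (rule derivative_eq_intros refl | simp)+
      then have "((\<lambda>x. ln (shifted_norm_sq x s)) has_real_derivative 1 / shifted_norm_sq x s * ?D) (at x)"
        by (rule DERIV_chain2[OF DERIV_ln_divide, rotated]) (use ge in simp)
      from DERIV_cdivide[OF this, of 2]
      have "((\<lambda>x. ln (shifted_norm_sq x s) / 2) has_real_derivative log_kernel x s) (at x)"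
        by (rule DERIV_cong) (use True in \<open>simp add: log_kernel_def algebra_simps add_divide_distrib\<close>)
      then have "((\<lambda>x. ln (shifted_norm_sq x s) / 2) has_vector_derivative log_kernel x s) (at x)"
        by (simp add: has_real_derivative_iff_has_vector_derivative)
      then show ?thesis
      proof (rule has_vector_derivative_transform_within_open)
        show "open ({0<..<\<theta>} \<inter> {4 * pi * \<bar>s\<bar> - pi<..})" by auto
        fix y assume "y \<in> {0<..<\<theta>} \<inter> {4 * pi * \<bar>s\<bar> - pi<..}"
        then have "1 \<le> shifted_norm_sq y s"
          using assms by (subst shifted_norm_sq_ge_1_iff) auto
        then show "ln (shifted_norm_sq y s) / 2 = ?F y" by simp
      qed (use x True in auto)
    next
      case False
      have "((\<lambda>x. 0) has_vector_derivative 0) (at x)" by simp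
      then have "(?F has_vector_derivative 0) (at x)"
      proof (rule has_vector_derivative_transform_within_open)
        show "open ({0<..<\<theta>} \<inter> {..<4 * pi * \<bar>s\<bar> - pi})" by auto
        fix y assume y: "y \<in> {0<..<\<theta>} \<inter> {..<4 * pi * \<bar>s\<bar> - pi}"
        then have "\<not> 1 \<le> shifted_norm_sq y s"
          using assms by (subst shifted_norm_sq_ge_1_iff) auto
        then show "0 = ?F y" by simp
      qed (use x False in auto)
      then show ?thesis using False by (simp add: log_kernel_def)
    qed
  qed (use assms in auto)
  then show ?thesis by (simp add: shifted_norm_sq_def)
qed

lemma log_kernel_has_integral_s:
  assumes "0 < x" "x < pi"
  shows "(log_kernel x has_integral x * cos (x / 2) / (2 * sin (x / 2)) / pi) {-(1/2)..1/2}"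
proof -
  let ?\<rho> = "2 * sin (x / 2)" and ?c = "cos (x / 2) / (2 * sin (x / 2))"
  let ?A = "\<lambda>s. arctan (sin (2 * pi * s) / (?\<rho> + cos (2 * pi * s)))"
  let ?G = "\<lambda>s. ?c * (s - ?A s / (2 * pi))"
  define b where "b = (x + pi) / (4 * pi)"
  have b: "0 < b" "b < 1 / 2" using assms by (auto simp: b_def field_simps)
  have sin_pos: "sin (x / 2) > 0" using assms by (intro sin_gt_zero) auto
  have b_iff: "4 * pi * \<bar>s\<bar> - pi \<le> x \<longleftrightarrow> s \<in> {-b..b}" for s
  proof -
    have "4 * pi * \<bar>s\<bar> - pi \<le> x \<longleftrightarrow> \<bar>s\<bar> \<le> b"
      by (simp add: b_def field_simps)
    then show ?thesis by auto
  qed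
  let ?f = "\<lambda>s. cos (x / 2) * (2 * sin (x / 2) + cos (2 * pi * s)) / shifted_norm_sq x s"
  have "(?f has_integral ?G b - ?G (-b)) {-b..b}"
  proof (rule fundamental_theorem_of_calculus)
    fix s assume s: "s \<in> {-b..b}"
    then have "0 \<le> sin (x / 2) + cos (2 * pi * s)"
      using b_iff[of s] sin_add_cos_nonneg_iff[of x s] assms b by auto
    then have pos: "?\<rho> + cos (2 * pi * s) > 0" using sin_pos by linarith
    let ?C = "cos (2 * pi * s)" and ?S = "sin (2 * pi * s)"
    have N: "(?\<rho> + ?C)\<^sup>2 + ?S\<^sup>2 = shifted_norm_sq x s"
    proof -
      have "(?\<rho> + ?C)\<^sup>2 + ?S\<^sup>2 = shifted_norm_sq x s + (?S\<^sup>2 + ?C\<^sup>2 - 1)"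
        unfolding shifted_norm_sq_def by (simp add: power2_eq_square algebra_simps del: sin_cos_squared_add sin_cos_squared_add2 sin_cos_squared_add3)
      then show ?thesis by simp
    qed
    have Npos: "shifted_norm_sq x s > 0"
      unfolding N[symmetric] using pos by (intro add_pos_nonneg) simp_all
    have "(?A has_real_derivative
            (2 * pi * ?C * (?\<rho> + ?C) + 2 * pi * ?S * ?S) / (?\<rho> + ?C)\<^sup>2 / (1 + (?S / (?\<rho> + ?C))\<^sup>2)) (at s)"
      using pos by (auto intro!: derivative_eq_intros simp: power2_eq_square field_simps)
    also have "(2 * pi * ?C * (?\<rho> + ?C) + 2 * pi * ?S * ?S) / (?\<rho> + ?C)\<^sup>2 / (1 + (?S / (?\<rho> + ?C))\<^sup>2)
        = 2 * pi * ((1 + ?\<rho> * ?C) / shifted_norm_sq x s)"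
    proof -
      have "1 + (?S / (?\<rho> + ?C))\<^sup>2 = shifted_norm_sq x s / (?\<rho> + ?C)\<^sup>2"
        using pos by (simp add: power_divide field_simps flip: N)
      moreover have "2 * pi * ?C * (?\<rho> + ?C) + 2 * pi * ?S * ?S = 2 * pi * ((?S\<^sup>2 + ?C\<^sup>2) + ?\<rho> * ?C)"
        by (simp add: power2_eq_square algebra_simps del: sin_cos_squared_add sin_cos_squared_add2 sin_cos_squared_add3)
      ultimately show ?thesis using pos by simp
    qed
    finally have A: "(?A has_real_derivative 2 * pi * ((1 + ?\<rho> * ?C) / shifted_norm_sq x s)) (at s)" .
    have "(?G has_real_derivative ?c * (1 - (1 + ?\<rho> * ?C) / shifted_norm_sq x s)) (at s)"
      by (rule derivative_eq_intros A refl | simp)+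
    moreover have "?c * (1 - (1 + ?\<rho> * ?C) / shifted_norm_sq x s) = ?f s"
    proof -
      have "shifted_norm_sq x s - (1 + ?\<rho> * ?C) = ?\<rho> * (?\<rho> + ?C)"
        by (simp add: shifted_norm_sq_def power2_eq_square algebra_simps)
      then have "1 - (1 + ?\<rho> * ?C) / shifted_norm_sq x s = ?\<rho> * (?\<rho> + ?C) / shifted_norm_sq x s"
        using Npos by (metis diff_divide_distrib divide_self less_irrefl)
      then show ?thesis using sin_pos by simp
    qed
    ultimately have "(?G has_real_derivative ?f s) (at s)"
      by (simp only:)
    then show "(?G has_vector_derivative ?f s) (at s within {-b..b})"
      unfolding has_real_derivative_iff_has_vector_derivative[symmetric]
      by (rule has_field_derivative_at_within)
  qed (use b in auto)
  moreover have "?G b - ?G (-b) = x * cos (x / 2) / (2 * sin (x / 2)) / pi"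
  proof -
    have "2 * pi * b = pi / 2 + x / 2" by (simp add: b_def field_simps)
    then have "sin (2 * pi * b) = cos (x / 2)" "cos (2 * pi * b) = - sin (x / 2)"
      by (simp_all add: sin_add cos_add)
    then have "?A b = arctan (cos (x / 2) / sin (x / 2))" by simp
    also have "cos (x / 2) / sin (x / 2) = tan (pi / 2 - x / 2)"
      by (simp add: tan_def sin_diff cos_diff)
    also have "arctan \<dots> = pi / 2 - x / 2"
      using assms by (intro arctan_tan) auto
    finally have "?A b = pi / 2 - x / 2" .
    moreover have "?A (-b) = - ?A b" by (simp add: arctan_minus)
    moreover have "c * (b - A / (2 * pi)) - c * (- b - A' / (2 * pi)) = c * (2 * b - (pi - x) / (2 * pi))"
      if "A = pi / 2 - x / 2" "A' = - A" for c A A' :: real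
      unfolding that by (simp add: field_simps)
    ultimately have "?G b - ?G (-b) = ?c * (2 * b - (pi - x) / (2 * pi))"
      by blast
    also have "2 * b - (pi - x) / (2 * pi) = x / pi"
      by (simp add: b_def field_simps)
    finally show ?thesis by simp
  qed
  ultimately have "(?f has_integral x * cos (x / 2) / (2 * sin (x / 2)) / pi) {-b..b}" by simp
  moreover have "log_kernel x = (\<lambda>s. if s \<in> {-b..b} then ?f s else 0)"
    by (rule ext) (simp add: log_kernel_def b_iff)
  moreover have "{-b..b} \<subseteq> {-(1/2)..1/2}" using b by auto
  ultimately show ?thesis by (simp only: has_integral_restrict)
qed

lemma abs_log_kernel_le_1:
  assumes "0 \<le> x" "x \<le> pi" "\<bar>s\<bar> \<le> 1 / 2"
  shows "\<bar>log_kernel x s\<bar> \<le> 1"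
proof (cases "4 * pi * \<bar>s\<bar> - pi \<le> x \<and> x \<noteq> 0")
  case True
  let ?y = "2 * sin (x / 2) + cos (2 * pi * s)"
  have ge: "1 \<le> shifted_norm_sq x s"
    using True assms by (subst shifted_norm_sq_ge_1_iff) auto
  have "?y\<^sup>2 = shifted_norm_sq x s - (sin (2 * pi * s))\<^sup>2"
    by (simp add: shifted_norm_sq_def sin_squared_eq power2_eq_square algebra_simps)
  then have "?y\<^sup>2 \<le> shifted_norm_sq x s" by simp
  also have "\<dots> \<le> (shifted_norm_sq x s)\<^sup>2"
    using ge by (simp add: power2_eq_square)
  finally have "\<bar>?y\<bar> \<le> shifted_norm_sq x s"
    using ge abs_le_square_iff[of ?y "shifted_norm_sq x s"] by simp
  then have "\<bar>cos (x / 2)\<bar> * \<bar>?y\<bar> \<le> 1 * shifted_norm_sq x s"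
    by (intro mult_mono) auto
  then show ?thesis
    using ge True by (simp add: log_kernel_def abs_mult divide_le_eq)
next
  case False
  then show ?thesis by (auto simp: log_kernel_def shifted_norm_sq_def)
qed

lemma measurable_log_kernel:
  "(\<lambda>p. log_kernel (fst p) (snd p)) \<in> borel_measurable (borel \<Otimes>\<^sub>M borel)"
proof -
  have "(\<lambda>p::real\<times>real. cos (fst p / 2) * (2 * sin (fst p / 2) + cos (2 * pi * snd p))) \<in> borel_measurable (borel \<Otimes>\<^sub>M borel)"
    "(\<lambda>p. shifted_norm_sq (fst p) (snd p)) \<in> borel_measurable (borel \<Otimes>\<^sub>M borel)"
    unfolding borel_prod shifted_norm_sq_def
    by (auto intro!: borel_measurable_continuous_onI continuous_intros)
  moreover note [measurable] = this
  show ?thesis unfolding log_kernel_def by measurable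
qed

lemma integral_ln_max_cmod_symmetric:
  assumes "0 \<le> \<theta>" "\<theta> \<le> pi"
  shows "integral {-(1/2)..1/2} (\<lambda>s. ln (max 1 (cmod (of_real (2 * sin (\<theta> / 2)) + expi s)))) =
           log_sine_Clausen \<theta> / pi"
proof -
  have "integral {-(1/2)..1/2} (\<lambda>s. ln (max 1 (cmod (of_real (2 * sin (\<theta> / 2)) + expi s)))) =
          integral {-(1/2)..1/2} (\<lambda>s. integral {0..\<theta>} (\<lambda>x. log_kernel x s))"
    unfolding ln_max_cmod_add_expi
    by (intro integral_cong integral_unique[symmetric] log_kernel_has_integral_x assms) auto
  also have "\<dots> = integral {0..\<theta>} (\<lambda>x. integral {-(1/2)..1/2} (log_kernel x))"
    by (rule integral_swap_bounded[OF measurable_log_kernel, symmetric, where B = 1])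
       (use assms in \<open>auto intro!: abs_log_kernel_le_1\<close>)
  also have "\<dots> = integral {0..\<theta>} (\<lambda>x. x * cos (x / 2) / (2 * sin (x / 2)) / pi)"
  proof (rule integral_spike[of "{0, pi}"])
    fix x assume "x \<in> {0..\<theta>} - {0, pi}"
    then show "x * cos (x / 2) / (2 * sin (x / 2)) / pi = integral {-(1/2)..1/2} (log_kernel x)"
      using assms by (intro integral_unique[symmetric] log_kernel_has_integral_s) auto
  qed auto
  also have "\<dots> = log_sine_Clausen \<theta> / pi"
    using has_integral_divide[OF log_sine_Clausen_has_integral[OF assms], of pi]
    by (rule integral_unique)
  finally show ?thesis .
qed

lemma integral_ln_max_cmod:
  assumes "0 \<le> \<theta>" "\<theta> \<le> pi" and c: "cmod c = 2 * sin (\<theta> / 2)"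
  shows "integral {0..1} (\<lambda>s. ln (max 1 (cmod (c + expi s)))) = log_sine_Clausen \<theta> / pi"
proof -
  define g where "g s = ln (max 1 (cmod (of_real (cmod c) + expi s)))" for s
  have cont: "continuous_on UNIV g"
    unfolding g_def by (intro continuous_intros) auto
  have "expi 1 = 1" by (simp add: exp_eq_1)
  then have per: "g (s + 1) = g s" for s
    unfolding g_def expi_add by simp
  obtain t where t: "0 \<le> t" "t < 1" and ct: "c = of_real (cmod c) * expi t"
  proof
    show "0 \<le> Arg2pi c / (2 * pi)" "Arg2pi c / (2 * pi) < 1"
      using Arg2pi_ge_0[of c] Arg2pi_lt_2pi[of c] by auto
    show "c = of_real (cmod c) * expi (Arg2pi c / (2 * pi))"
      using Arg2pi_eq[of c] by (simp add: mult_ac)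
  qed
  have g_shift: "ln (max 1 (cmod (c + expi s))) = g (s - t)" for s
  proof -
    have "c + expi s = expi t * (of_real (cmod c) + expi (s - t))"
      using expi_add[of t "s - t"] ct by (simp add: algebra_simps)
    then have "cmod (c + expi s) = cmod (of_real (cmod c) + expi (s - t))"
      by (simp only: norm_mult cmod_expi mult_1)
    then show ?thesis by (simp add: g_def)
  qed
  have "integral {0..1} (\<lambda>s. g (s - t)) = integral {-t..1 - t} g"
    using integral_shift_real_ivl[of "-t" "-t" "1 - t" g] by simp
  also have "\<dots> = integral {0..1} g"
    using t by (intro integral_periodic_shift cont per) auto
  also have "\<dots> = integral {-(1/2)..1 - 1/2} g"
    by (intro integral_periodic_shift[symmetric] cont per) auto
  also have "\<dots> = log_sine_Clausen \<theta> / pi"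
    using integral_ln_max_cmod_symmetric[OF assms(1,2)] by (simp add: g_def[abs_def] c)
  finally show ?thesis by (simp add: g_shift)
qed

subsection \<open>The product measure\<close>

text \<open>The coordinates \<open>j\<close> and \<open>k + j\<close> (for \<open>1 \<le> j \<le> k\<close>) are grouped into pairs, which
  turns the integrand into a product of independent factors once coordinate 0 is fixed.\<close>

definition split_pairs :: "nat \<Rightarrow> 'a \<times> (nat \<Rightarrow> 'a \<times> 'a) \<Rightarrow> nat \<Rightarrow> 'a" where
  "split_pairs k = (\<lambda>(x, w). \<lambda>i\<in>{..<2 * k + 1}. if i = 0 then x else if i \<le> k then fst (w i) else snd (w (i - k)))"

lemma prod_split_pairs:
  fixes e :: "nat \<Rightarrow> 'a::comm_monoid_mult"
  shows "(\<Prod>i<2 * k + 1. e i) = e 0 * (\<Prod>j\<in>{1..k}. e j * e (k + j))"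
proof -
  have "{..<2 * k + 1} = insert 0 ({1..k} \<union> {k + 1..k + k})" by auto
  also have "(\<Prod>i\<in>\<dots>. e i) = e 0 * (\<Prod>i\<in>{1..k} \<union> {k + 1..k + k}. e i)"
    by (rule prod.insert) auto
  also have "(\<Prod>i\<in>{1..k} \<union> {k + 1..k + k}. e i) = (\<Prod>j\<in>{1..k}. e j) * (\<Prod>j\<in>{k + 1..k + k}. e j)"
    by (rule prod.union_disjoint) auto
  also have "(\<Prod>j\<in>{k + 1..k + k}. e j) = (\<Prod>j\<in>{1..k}. e (k + j))"
    by (rule prod.reindex_bij_witness[of _ "\<lambda>j. k + j" "\<lambda>i. i - k"]) auto
  finally show ?thesis by (simp add: prod.distrib)
qed

lemma split_pairs_measurable:
  "split_pairs k \<in> (M \<Otimes>\<^sub>M PiM {1..k} (\<lambda>_. M \<Otimes>\<^sub>M M)) \<rightarrow>\<^sub>M PiM {..<2 * k + 1} (\<lambda>_. M)"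
  unfolding split_pairs_def case_prod_unfold
proof (rule measurable_restrict)
  fix i assume i: "i \<in> {..<2 * k + 1}"
  let ?Q = "M \<Otimes>\<^sub>M PiM {1..k} (\<lambda>_. M \<Otimes>\<^sub>M M)"
  have comp: "(\<lambda>p. snd p j) \<in> ?Q \<rightarrow>\<^sub>M M \<Otimes>\<^sub>M M" if "j \<in> {1..k}" for j
    by (rule measurable_compose[OF measurable_snd measurable_component_singleton[OF that]])
  consider "i = 0" | "i \<noteq> 0" "i \<le> k" | "i \<noteq> 0" "\<not> i \<le> k" by blast
  then show "(\<lambda>p. if i = 0 then fst p else if i \<le> k then fst (snd p i) else snd (snd p (i - k))) \<in> ?Q \<rightarrow>\<^sub>M M"
  proof cases
    case 2
    then have "i \<in> {1..k}" by simp
    from measurable_compose[OF comp[OF this] measurable_fst] 2 show ?thesis by simp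
  next
    case 3
    then have "i - k \<in> {1..k}" using i by auto
    from measurable_compose[OF comp[OF this] measurable_snd] 3 show ?thesis by simp
  qed simp
qed

lemma distr_split_pairs:
  assumes "sigma_finite_measure M"
  shows "distr (M \<Otimes>\<^sub>M PiM {1..k} (\<lambda>_. M \<Otimes>\<^sub>M M)) (PiM {..<2 * k + 1} (\<lambda>_. M)) (split_pairs k)
           = PiM {..<2 * k + 1} (\<lambda>_. M)"
proof -
  interpret M: sigma_finite_measure M by fact
  interpret MM: pair_sigma_finite M M ..
  interpret PM: product_sigma_finite "\<lambda>_::nat. M" ..
  interpret PP: product_sigma_finite "\<lambda>_::nat. M \<Otimes>\<^sub>M M" ..
  interpret P: finite_product_sigma_finite "\<lambda>_::nat. M \<Otimes>\<^sub>M M" "{1..k}" by standard simp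
  interpret Q: pair_sigma_finite M "PiM {1..k} (\<lambda>_. M \<Otimes>\<^sub>M M)" ..
  let ?Q = "M \<Otimes>\<^sub>M PiM {1..k} (\<lambda>_. M \<Otimes>\<^sub>M M)"
  show ?thesis
  proof (rule PM.PiM_eqI)
    fix A :: "nat \<Rightarrow> 'a set"
    assume A: "\<And>i. i \<in> {..<2 * k + 1} \<Longrightarrow> A i \<in> sets M"
    then have sub: "A i \<subseteq> space M" if "i < 2 * k + 1" for i
      using that sets.sets_into_space by blast
    have A1: "A j \<in> sets M" "A (k + j) \<in> sets M" if "j \<in> {1..k}" for j
      using that by (auto intro!: A)
    have A0: "A 0 \<in> sets M" by (rule A) simp
    have "(split_pairs k q \<in> Pi\<^sub>E {..<2 * k + 1} A \<and> q \<in> space ?Q)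
            = (q \<in> A 0 \<times> Pi\<^sub>E {1..k} (\<lambda>j. A j \<times> A (k + j)))" for q
    proof (cases q)
      case (Pair x w)
      let ?v = "\<lambda>i. if i = 0 then x else if i \<le> k then fst (w i) else snd (w (i - k))"
      have "split_pairs k q \<in> Pi\<^sub>E {..<2 * k + 1} A \<longleftrightarrow> (\<forall>i\<in>{..<2 * k + 1}. ?v i \<in> A i)"
        unfolding split_pairs_def Pair by (simp only: prod.case restrict_PiE_iff)
      also have "\<dots> \<longleftrightarrow> x \<in> A 0 \<and> (\<forall>j\<in>{1..k}. fst (w j) \<in> A j \<and> snd (w j) \<in> A (k + j))"
      proof
        assume L: "\<forall>i\<in>{..<2 * k + 1}. ?v i \<in> A i"
        have "fst (w j) \<in> A j \<and> snd (w j) \<in> A (k + j)" if "j \<in> {1..k}" for j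
          using L[rule_format, of j] L[rule_format, of "k + j"] that by auto
        then show "x \<in> A 0 \<and> (\<forall>j\<in>{1..k}. fst (w j) \<in> A j \<and> snd (w j) \<in> A (k + j))"
          using L[rule_format, of 0] by simp
      next
        assume R: "x \<in> A 0 \<and> (\<forall>j\<in>{1..k}. fst (w j) \<in> A j \<and> snd (w j) \<in> A (k + j))"
        show "\<forall>i\<in>{..<2 * k + 1}. ?v i \<in> A i"
        proof
          fix i assume i: "i \<in> {..<2 * k + 1}"
          show "?v i \<in> A i"
          proof (cases "i \<le> k")
            case True
            then show ?thesis using R by auto
          next
            case False
            then have "i - k \<in> {1..k}" "k + (i - k) = i" using i by auto
            with R False show ?thesis by fastforce
          qed
        qed
      qed
      finally have *: "split_pairs k q \<in> Pi\<^sub>E {..<2 * k + 1} A \<longleftrightarrow>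
          x \<in> A 0 \<and> (\<forall>j\<in>{1..k}. w j \<in> A j \<times> A (k + j))"
        by (simp add: mem_Times_iff)
      have sp: "q \<in> space ?Q \<longleftrightarrow> x \<in> space M \<and> w \<in> Pi\<^sub>E {1..k} (\<lambda>_. space M \<times> space M)"
        by (simp add: Pair space_pair_measure space_PiM)
      have "A j \<times> A (k + j) \<subseteq> space M \<times> space M" if "j \<in> {1..k}" for j
        using that by (intro Sigma_mono sub) auto
      moreover have "A 0 \<subseteq> space M" by (rule sub) simp
      ultimately show ?thesis
        unfolding * sp unfolding Pair mem_Sigma_iff PiE_iff by blast
    qed
    then have eq: "split_pairs k -` Pi\<^sub>E {..<2 * k + 1} A \<inter> space ?Q
        = A 0 \<times> Pi\<^sub>E {1..k} (\<lambda>j. A j \<times> A (k + j))"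
      by blast
    have "emeasure (distr ?Q (PiM {..<2 * k + 1} (\<lambda>_. M)) (split_pairs k)) (Pi\<^sub>E {..<2 * k + 1} A)
        = emeasure ?Q (A 0 \<times> Pi\<^sub>E {1..k} (\<lambda>j. A j \<times> A (k + j)))"
      by (subst emeasure_distr[OF split_pairs_measurable])
         (auto simp only: eq intro!: sets_PiM_I_finite A finite_lessThan)
    also have "\<dots> = emeasure M (A 0) * emeasure (PiM {1..k} (\<lambda>_. M \<Otimes>\<^sub>M M)) (Pi\<^sub>E {1..k} (\<lambda>j. A j \<times> A (k + j)))"
      by (rule P.emeasure_pair_measure_Times)
         (auto intro!: sets_PiM_I_finite pair_measureI A0 A1)
    also have "emeasure (PiM {1..k} (\<lambda>_. M \<Otimes>\<^sub>M M)) (Pi\<^sub>E {1..k} (\<lambda>j. A j \<times> A (k + j)))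
        = (\<Prod>j\<in>{1..k}. emeasure (M \<Otimes>\<^sub>M M) (A j \<times> A (k + j)))"
      by (rule PP.emeasure_PiM) (auto intro!: pair_measureI A1)
    also have "\<dots> = (\<Prod>j\<in>{1..k}. emeasure M (A j) * emeasure M (A (k + j)))"
      by (intro prod.cong refl M.emeasure_pair_measure_Times A1)
    finally show "emeasure (distr ?Q (PiM {..<2 * k + 1} (\<lambda>_. M)) (split_pairs k)) (Pi\<^sub>E {..<2 * k + 1} A)
        = (\<Prod>i<2 * k + 1. emeasure M (A i))"
      unfolding prod_split_pairs .
  qed auto
qed

lemma integral_PiM_prod_pairs:
  fixes h :: "'a \<Rightarrow> 'a \<times> 'a \<Rightarrow> real"
  assumes "finite_measure M"
    and h [measurable]: "case_prod h \<in> borel_measurable (M \<Otimes>\<^sub>M (M \<Otimes>\<^sub>M M))"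
    and int: "\<And>x. x \<in> space M \<Longrightarrow> integrable (M \<Otimes>\<^sub>M M) (h x)"
    and bound: "\<And>x. x \<in> space M \<Longrightarrow> (LINT p|(M \<Otimes>\<^sub>M M). \<bar>h x p\<bar>) \<le> C"
  shows "(LINT t|(PiM {..<2 * k + 1} (\<lambda>_. M)). (\<Prod>j\<in>{1..k}. h (t 0) (t j, t (k + j))))
           = (LINT x|M. (LINT p|(M \<Otimes>\<^sub>M M). h x p) ^ k)"
proof -
  interpret M: finite_measure M by fact
  interpret MM: pair_sigma_finite M M ..
  interpret PP: product_sigma_finite "\<lambda>_::nat. M \<Otimes>\<^sub>M M" ..
  interpret P: finite_product_sigma_finite "\<lambda>_::nat. M \<Otimes>\<^sub>M M" "{1..k}" by standard simp
  let ?P = "PiM {1..k} (\<lambda>_. M \<Otimes>\<^sub>M M)"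
  interpret Q: pair_sigma_finite M ?P ..
  let ?f = "\<lambda>(x, w). \<Prod>j\<in>{1..k}. h x (w j)"
  have prod_int: "(LINT w|?P. (\<Prod>j\<in>{1..k}. g (w j))) = (LINT p|(M \<Otimes>\<^sub>M M). g p) ^ k"
    if "integrable (M \<Otimes>\<^sub>M M) g" for g :: "'a \<times> 'a \<Rightarrow> real"
    using PP.product_integral_prod[of "{1..k}" "\<lambda>_. g"] that by simp
  have h_comp: "(\<lambda>p. h (fst p) (g p)) \<in> borel_measurable N"
    if "fst \<in> N \<rightarrow>\<^sub>M M" "g \<in> N \<rightarrow>\<^sub>M M \<Otimes>\<^sub>M M" for g and N :: "('a \<times> 'b) measure"
    using measurable_compose[OF measurable_Pair[OF that] h] by simp
  have f_meas: "?f \<in> borel_measurable (M \<Otimes>\<^sub>M ?P)"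
    unfolding case_prod_unfold
    by (intro borel_measurable_prod h_comp measurable_fst
        measurable_compose[OF measurable_snd measurable_component_singleton]) auto
  have abs_meas: "(\<lambda>x. LINT p|(M \<Otimes>\<^sub>M M). \<bar>h x p\<bar>) \<in> borel_measurable M"
    by (rule MM.P.borel_measurable_lebesgue_integral) measurable
  have f_int: "integrable (M \<Otimes>\<^sub>M ?P) ?f"
  proof (rule Q.Fubini_integrable[OF f_meas])
    have "integrable M (\<lambda>x. (LINT p|(M \<Otimes>\<^sub>M M). \<bar>h x p\<bar>) ^ k)"
    proof (rule M.integrable_const_bound[of _ "C ^ k"])
      show "AE x in M. norm ((LINT p|(M \<Otimes>\<^sub>M M). \<bar>h x p\<bar>) ^ k) \<le> C ^ k"
        using bound by (auto intro!: AE_I2 power_mono simp: power_abs)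
    qed (use abs_meas in measurable)
    also have "?this \<longleftrightarrow> integrable M (\<lambda>x. LINT w|?P. norm (?f (x, w)))"
      by (intro Bochner_Integration.integrable_cong refl)
         (simp only: prod.case real_norm_def abs_prod prod_int[OF integrable_abs[OF int]])
    finally show "integrable M (\<lambda>x. LINT w|?P. norm (?f (x, w)))" .
    show "AE x in M. integrable ?P (\<lambda>w. ?f (x, w))"
      using int by (auto intro!: AE_I2 PP.product_integrable_prod)
  qed
  let ?H = "\<lambda>t. \<Prod>j\<in>{1..k}. h (t 0) (t j, t (k + j))"
  have H_meas: "?H \<in> borel_measurable (PiM {..<2 * k + 1} (\<lambda>_. M))"
  proof (intro borel_measurable_prod)
    fix j assume "j \<in> {1..k}"
    then have [measurable]: "(\<lambda>t. t 0) \<in> PiM {..<2 * k + 1} (\<lambda>_. M) \<rightarrow>\<^sub>M M"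
      "(\<lambda>t. t j) \<in> PiM {..<2 * k + 1} (\<lambda>_. M) \<rightarrow>\<^sub>M M"
      "(\<lambda>t. t (k + j)) \<in> PiM {..<2 * k + 1} (\<lambda>_. M) \<rightarrow>\<^sub>M M"
      by (auto intro!: measurable_component_singleton)
    have "(\<lambda>t. (t 0, t j, t (k + j))) \<in> PiM {..<2 * k + 1} (\<lambda>_. M) \<rightarrow>\<^sub>M M \<Otimes>\<^sub>M (M \<Otimes>\<^sub>M M)"
      by measurable
    from measurable_compose[OF this h]
    show "(\<lambda>t. h (t 0) (t j, t (k + j))) \<in> borel_measurable (PiM {..<2 * k + 1} (\<lambda>_. M))"
      by simp
  qed
  have "(LINT t|(PiM {..<2 * k + 1} (\<lambda>_. M)). ?H t)
      = (LINT t|(distr (M \<Otimes>\<^sub>M ?P) (PiM {..<2 * k + 1} (\<lambda>_. M)) (split_pairs k)). ?H t)"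
    by (subst distr_split_pairs) (auto intro: M.sigma_finite_measure_axioms)
  also have "\<dots> = (LINT q|(M \<Otimes>\<^sub>M ?P). ?H (split_pairs k q))"
    by (rule integral_distr[OF split_pairs_measurable H_meas])
  also have "\<dots> = (LINT q|(M \<Otimes>\<^sub>M ?P). ?f q)"
    by (intro Bochner_Integration.integral_cong refl)
       (auto simp: split_pairs_def intro!: prod.cong)
  also have "\<dots> = (LINT x|M. LINT w|?P. ?f (x, w))"
    by (rule Q.integral_fst'[OF f_int, symmetric])
  also have "\<dots> = (LINT x|M. (LINT p|(M \<Otimes>\<^sub>M M). h x p) ^ k)"
    by (intro Bochner_Integration.integral_cong refl) (simp only: prod.case prod_int[OF int])
  finally show ?thesis .
qed

lemma ln_cmod_add_two:
  fixes c :: complex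
  assumes "cmod c \<le> R"
  shows integrable_ln_cmod_add_two:
      "integrable (unit_interval \<Otimes>\<^sub>M unit_interval) (\<lambda>(s, u). ln (cmod (c + expi s + expi u)))" (is "integrable _ ?f")
    and integral_ln_cmod_add_two:
      "(LINT p|(unit_interval \<Otimes>\<^sub>M unit_interval). (\<lambda>(s, u). ln (cmod (c + expi s + expi u))) p)
         = integral {0..1} (\<lambda>s. ln (max 1 (cmod (c + expi s))))"
    and integral_abs_ln_cmod_add_two_le:
      "(LINT p|(unit_interval \<Otimes>\<^sub>M unit_interval). \<bar>(\<lambda>(s, u). ln (cmod (c + expi s + expi u))) p\<bar>)
         \<le> 2 * ln (R + 2)"
proof -
  interpret U: finite_measure unit_interval by (rule finite_measure_interval)
  interpret UU: pair_sigma_finite unit_interval unit_interval ..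
  have expi: "expi \<in> borel_measurable borel"
    by (intro borel_measurable_continuous_onI continuous_intros)
  have meas [measurable]: "?f \<in> borel_measurable (unit_interval \<Otimes>\<^sub>M unit_interval)"
  proof -
    have "(\<lambda>p. expi (fst p)) \<in> borel_measurable (unit_interval \<Otimes>\<^sub>M unit_interval)"
      "(\<lambda>p. expi (snd p)) \<in> borel_measurable (unit_interval \<Otimes>\<^sub>M unit_interval)"
      by (auto intro!: measurable_compose[OF measurable_fst] measurable_compose[OF measurable_snd]
          measurable_restrict_space1 expi)
    moreover note [measurable] = this
    show ?thesis unfolding case_prod_unfold by measurable
  qed
  have le: "cmod (c + expi s) \<le> R + 1" for s
    using norm_triangle_ineq[of c "expi s"] assms by simp
  have abs_le: "(LINT u|unit_interval. \<bar>ln (cmod (c + expi s + expi u))\<bar>) \<le> 2 * ln (R + 2)" for s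
    using integral_abs_ln_cmod_le[OF le[of s]] by (simp add: add.assoc)
  have abs_int: "integrable unit_interval (\<lambda>s. LINT u|unit_interval. \<bar>?f (s, u)\<bar>)"
  proof (rule U.integrable_const_bound[of _ "2 * ln (R + 2)"])
    show "AE s in unit_interval. norm (LINT u|unit_interval. \<bar>?f (s, u)\<bar>) \<le> 2 * ln (R + 2)"
      using abs_le by (auto intro!: AE_I2)
    show "(\<lambda>s. LINT u|unit_interval. \<bar>?f (s, u)\<bar>) \<in> borel_measurable unit_interval"
      by (rule U.borel_measurable_lebesgue_integral) (use borel_measurable_abs[OF meas] in \<open>simp add: case_prod_unfold\<close>)
  qed
  show int: "integrable (unit_interval \<Otimes>\<^sub>M unit_interval) ?f"
  proof (rule UU.Fubini_integrable[OF meas])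
    show "integrable unit_interval (\<lambda>s. LINT u|unit_interval. norm (?f (s, u)))"
      using abs_int by simp
  qed (auto intro: integrable_ln_cmod)
  have "(LINT p|(unit_interval \<Otimes>\<^sub>M unit_interval). ?f p) = (LINT s|unit_interval. LINT u|unit_interval. ?f (s, u))"
    by (rule UU.integral_fst'[OF int, symmetric])
  also have "\<dots> = (LINT s|unit_interval. ln (max 1 (cmod (c + expi s))))"
    by (simp add: integral_ln_cmod)
  also have "\<dots> = integral {0..1} (\<lambda>s. ln (max 1 (cmod (c + expi s))))"
    by (intro integral_unique[symmetric] has_integral_interval_measure
        integrable_interval_measure_continuous continuous_intros) auto
  finally show "(LINT p|(unit_interval \<Otimes>\<^sub>M unit_interval). ?f p) = integral {0..1} (\<lambda>s. ln (max 1 (cmod (c + expi s))))" .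
  have "(LINT p|(unit_interval \<Otimes>\<^sub>M unit_interval). \<bar>?f p\<bar>) = (LINT s|unit_interval. LINT u|unit_interval. \<bar>?f (s, u)\<bar>)"
    by (rule UU.integral_fst'[OF integrable_abs[OF int], symmetric])
  also have "\<dots> \<le> (LINT s|unit_interval. 2 * ln (R + 2))"
    using abs_le by (intro integral_mono abs_int) auto
  also have "\<dots> = 2 * ln (R + 2)" by (simp add: space_restrict_space)
  finally show "(LINT p|(unit_interval \<Otimes>\<^sub>M unit_interval). \<bar>?f p\<bar>) \<le> 2 * ln (R + 2)" .
qed

lemma abs_pi_minus_le_pi:
  assumes "0 \<le> x" "x \<le> 1"
  shows "\<bar>pi - 2 * pi * x\<bar> \<le> pi"
proof -
  have "0 \<le> pi * x" "pi * x \<le> pi * 1"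
    using assms by (auto intro!: mult_left_mono)
  then show ?thesis by linarith
qed

lemma cmod_1_add_expi:
  assumes "0 \<le> x" "x \<le> 1"
  shows "cmod (1 + expi x) = 2 * sin (\<bar>pi - 2 * pi * x\<bar> / 2)"
proof -
  have "1 + expi x = expi (x / 2) * (expi (x / 2) + expi (- (x / 2)))"
    using expi_add[of "x / 2" "x / 2"] expi_add[of "x / 2" "- (x / 2)"]
    by (simp only: distrib_left field_sum_of_halves add.right_inverse of_real_0 mult_zero_right exp_zero add.commute)
  moreover have "expi (x / 2) + expi (- (x / 2)) = of_real (2 * cos (pi * x))"
    by (simp add: cos_exp_eq mult_ac flip: cos_of_real)
  ultimately have "cmod (1 + expi x) = 2 * \<bar>cos (pi * x)\<bar>"
    by (simp only: norm_mult cmod_expi norm_of_real)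
  also have "\<bar>cos (pi * x)\<bar> = sin (\<bar>pi - 2 * pi * x\<bar> / 2)"
  proof (cases "x \<le> 1 / 2")
    case True
    then have x: "pi * x \<le> pi * (1 / 2)" "0 \<le> pi * x"
      using assms by (auto intro!: mult_left_mono)
    then have "0 \<le> pi - 2 * pi * x" by linarith
    then have *: "\<bar>pi - 2 * pi * x\<bar> / 2 = pi / 2 - pi * x"
      by (simp only: abs_of_nonneg) (simp add: field_simps)
    have "0 \<le> cos (pi * x)" by (rule cos_ge_zero) (use x pi_gt_zero in linarith)+
    then show ?thesis unfolding * sin_diff by simp
  next
    case False
    then have x: "pi * (1 / 2) \<le> pi * x" "pi * x \<le> pi * 1"
      using assms by (auto intro!: mult_left_mono)
    then have "pi - 2 * pi * x \<le> 0" by linarith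
    then have *: "\<bar>pi - 2 * pi * x\<bar> / 2 = pi * x - pi / 2"
      by (simp only: abs_of_nonpos) (simp add: field_simps)
    have "0 \<le> sin (pi * x - pi / 2)" by (rule sin_ge_zero) (use x pi_gt_zero in linarith)+
    then show ?thesis unfolding * sin_diff by simp
  qed
  finally show ?thesis .
qed

lemma integral_fold_interval:
  fixes g :: "real \<Rightarrow> real"
  assumes "continuous_on {0..pi} g"
  shows "integral {0..1} (\<lambda>x. g \<bar>pi - 2 * pi * x\<bar>) = integral {0..pi} g / pi"
proof -
  have "(g has_integral integral {0..pi} g) (cbox 0 pi)"
    using integrable_continuous_interval[OF assms] by (simp add: integrable_integral)
  note aff = has_integral_affinity[OF this]
  have "((\<lambda>x. g \<bar>pi - 2 * pi * x\<bar>) has_integral integral {0..pi} g / (2 * pi)) {0..1/2}"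
  proof (rule has_integral_eq)
    have im: "(\<lambda>x. (1 / (- 2 * pi)) *\<^sub>R x + - ((1 / (- 2 * pi)) *\<^sub>R pi)) ` cbox 0 pi = {0..1/2}"
      by (simp only: cbox_interval real_scaleR_def image_affinity_atLeastAtMost) (use pi_gt_zero in \<open>simp add: not_le\<close>)
    show "((\<lambda>x. g ((- 2 * pi) *\<^sub>R x + pi)) has_integral integral {0..pi} g / (2 * pi)) {0..1/2}"
      using aff[of "- 2 * pi" pi] unfolding im by simp
    show "g ((- 2 * pi) *\<^sub>R x + pi) = g \<bar>pi - 2 * pi * x\<bar>" if "x \<in> {0..1/2}" for x
      using that mult_left_mono[of x "1/2" pi] by simp
  qed
  moreover have "((\<lambda>x. g \<bar>pi - 2 * pi * x\<bar>) has_integral integral {0..pi} g / (2 * pi)) {1/2..1}"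
  proof (rule has_integral_eq)
    have im: "(\<lambda>x. (1 / (2 * pi)) *\<^sub>R x + - ((1 / (2 * pi)) *\<^sub>R (- pi))) ` cbox 0 pi = {1/2..1}"
      by (simp only: cbox_interval real_scaleR_def image_affinity_atLeastAtMost) (use pi_gt_zero in \<open>simp add: not_le\<close>)
    show "((\<lambda>x. g ((2 * pi) *\<^sub>R x + (- pi))) has_integral integral {0..pi} g / (2 * pi)) {1/2..1}"
      using aff[of "2 * pi" "- pi"] unfolding im by simp
    show "g ((2 * pi) *\<^sub>R x + (- pi)) = g \<bar>pi - 2 * pi * x\<bar>" if "x \<in> {1/2..1}" for x
      using that mult_left_mono[of "1/2" x pi] by simp
  qed
  ultimately have "((\<lambda>x. g \<bar>pi - 2 * pi * x\<bar>) has_integral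
      integral {0..pi} g / (2 * pi) + integral {0..pi} g / (2 * pi)) {0..1}"
    by (intro has_integral_combine[of 0 "1/2" 1]) auto
  then show ?thesis by (simp add: integral_unique)
qed

theorem theorem3p3:
  fixes k :: nat
  assumes "k \<ge> 1"
  shows "multiple_mahler (2 * k + 1)
           (map (\<lambda>j. \<lambda>w. 1 + w 0 + w j + w (k + j)) [1..<k+1])
         = 1 / pi ^ (k + 1) *
           integral {0..pi} (\<lambda>\<theta>. (\<theta> * ln (2 * sin (\<theta> / 2)) + Cl2 \<theta>) ^ k)"
proof -
  define h where "h x = (\<lambda>(s, u). ln (cmod (1 + expi x + expi s + expi u)))" for x
  have le2: "cmod (1 + expi x) \<le> 2" for x
    using norm_triangle_ineq[of 1 "expi x"] by simp
  have h_meas: "case_prod h \<in> borel_measurable (unit_interval \<Otimes>\<^sub>M (unit_interval \<Otimes>\<^sub>M unit_interval))"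
    (is "_ \<in> borel_measurable ?M3")
  proof -
    have expi: "expi \<in> borel_measurable unit_interval"
    proof (intro measurable_restrict_space1)
      have "expi \<in> borel_measurable borel"
        by (intro borel_measurable_continuous_onI continuous_intros)
      then show "expi \<in> borel_measurable lborel" by simp
    qed
    have "(\<lambda>p. expi (fst p)) \<in> borel_measurable ?M3"
      "(\<lambda>p. expi (fst (snd p))) \<in> borel_measurable ?M3"
      "(\<lambda>p. expi (snd (snd p))) \<in> borel_measurable ?M3"
      by (rule measurable_compose[OF measurable_fst expi]
            measurable_compose[OF measurable_compose[OF measurable_snd measurable_fst] expi]
            measurable_compose[OF measurable_compose[OF measurable_snd measurable_snd] expi])+
    moreover note [measurable] = this
    show ?thesis unfolding h_def case_prod_unfold by measurable
  qed
  have "multiple_mahler (2 * k + 1) (map (\<lambda>j. \<lambda>w. 1 + w 0 + w j + w (k + j)) [1..<k+1])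
      = (LINT t|(PiM {..<2 * k + 1} (\<lambda>_. unit_interval)). (\<Prod>j\<in>{1..k}. h (t 0) (t j, t (k + j))))"
  proof -
    have "prod_list (map f [1..<k+1]) = (\<Prod>j\<in>{1..k}. f j)" for f :: "nat \<Rightarrow> real"
      using prod.distinct_set_conv_list[of "[1..<k+1]" f] by (simp add: atLeastLessThanSuc_atLeastAtMost del: upt_Suc)
    then show ?thesis
      unfolding multiple_mahler_def h_def by (simp add: comp_def del: upt_Suc)
  qed
  also have "\<dots> = (LINT x|unit_interval. (LINT p|(unit_interval \<Otimes>\<^sub>M unit_interval). h x p) ^ k)"
    by (rule integral_PiM_prod_pairs[OF finite_measure_interval h_meas])
       (auto simp only: h_def intro!: integrable_ln_cmod_add_two[OF le2] integral_abs_ln_cmod_add_two_le[OF le2])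
  also have "\<dots> = (LINT x|unit_interval. (log_sine_Clausen \<bar>pi - 2 * pi * x\<bar> / pi) ^ k)"
  proof (intro Bochner_Integration.integral_cong refl)
    fix x assume "x \<in> space unit_interval"
    then have x: "0 \<le> x" "x \<le> 1" by (auto simp: space_restrict_space)
    then have "(LINT p|(unit_interval \<Otimes>\<^sub>M unit_interval). h x p) = log_sine_Clausen \<bar>pi - 2 * pi * x\<bar> / pi"
      unfolding h_def integral_ln_cmod_add_two[OF le2]
      by (intro integral_ln_max_cmod cmod_1_add_expi abs_pi_minus_le_pi x abs_ge_zero)
    then show "(LINT p|(unit_interval \<Otimes>\<^sub>M unit_interval). h x p) ^ k = (log_sine_Clausen \<bar>pi - 2 * pi * x\<bar> / pi) ^ k"
      by simp
  qed
  also have "\<dots> = integral {0..1} (\<lambda>x. (log_sine_Clausen \<bar>pi - 2 * pi * x\<bar> / pi) ^ k)"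
  proof (intro integral_unique[symmetric] has_integral_interval_measure
      integrable_interval_measure_continuous continuous_on_power continuous_on_divide)
    show "continuous_on {0..1} (\<lambda>x. log_sine_Clausen \<bar>pi - 2 * pi * x\<bar>)"
    proof (rule continuous_on_compose2[OF continuous_on_log_sine_Clausen])
      show "(\<lambda>x. \<bar>pi - 2 * pi * x\<bar>) ` {0..1} \<subseteq> {0..pi}"
        using abs_pi_minus_le_pi by fastforce
    qed (intro continuous_intros)
  qed (auto intro: continuous_intros)
  also have "\<dots> = integral {0..pi} (\<lambda>\<theta>. (log_sine_Clausen \<theta> / pi) ^ k) / pi"
    by (rule integral_fold_interval) (intro continuous_intros continuous_on_log_sine_Clausen, auto)
  also have "\<dots> = 1 / pi ^ (k + 1) * integral {0..pi} (\<lambda>\<theta>. log_sine_Clausen \<theta> ^ k)"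
    by (simp add: power_divide)
  finally show ?thesis by (simp only: log_sine_Clausen_def)
qed

end
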